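(* Let $p\ge 20$ be an integer and let $G_p=\langle a,t\mid t^{-1}a^{-1}tat^{-1}at=a^p\rangle$, with the word metric with respect to the generating set $\{a,t\}$. Then $a$ has infinite order and $t(a^\infty,a^{-\infty})\le\sqrt{12/17}$.
   Context: $d$ is the word metric of $G_p$ with respect to $\{a,t\}$. For $g$ of infinite order, $g^\infty=\{g^n:n\in\mathbb N\}$ and $g^{-\infty}=(g^{-1})^\infty$. For $\alpha>0$, $c\in\mathbb N$, the $(\alpha,c)$-cone around $g^\infty$ is $\alpha\cdot g^\infty+c=\{v:\exists n\in\mathbb N,\ d(v,g^n)\le\alpha\, d(1,g^n)+c\}$; for forward orbits $x,y$ write $x\subseteq\alpha\cdot y+c$ if every element of $x$ lies in the cone around $y$. Define $s(x,y)=\inf\{\alpha>0:\exists c\in\mathbb N,\ x\subseteq\alpha\cdot y+c\text{ and }y\subseteq\alpha\cdot x+c\}$ and $t(x,y)=\sqrt{s(x,y)}$. *)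

theory Defs
  imports Complex_Main
begin

text \<open>Words over the generators a, t and their inverses. A letter (g, False) is g,
  (g, True) is g inverse.\<close>

datatype gen = A | T

type_synonym letter = "gen \<times> bool"
type_synonym word = "letter list"

fun inv_letter :: "letter \<Rightarrow> letter" where
  "inv_letter (g, b) = (g, \<not> b)"

definition inv_word :: "word \<Rightarrow> word" where
  "inv_word w = rev (map inv_letter w)"

definition relator :: "nat \<Rightarrow> word" where
  "relator p = [(T,True),(A,True),(T,False),(A,False),(T,True),(A,False),(T,False)]
                @ replicate p (A,True)"

text \<open>Equality in G_p: the congruence on words generated by free cancellation and
  deletion of the relator (i.e. the word problem of the presentation).\<close>

inductive eqv :: "nat \<Rightarrow> word \<Rightarrow> word \<Rightarrow> bool" for p where
  eqv_refl: "eqv p w w"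
| eqv_sym: "eqv p u v \<Longrightarrow> eqv p v u"
| eqv_trans: "eqv p u v \<Longrightarrow> eqv p v w \<Longrightarrow> eqv p u w"
| eqv_cancel: "eqv p (u @ [x, inv_letter x] @ v) (u @ v)"
| eqv_rel: "eqv p (u @ relator p @ v) (u @ v)"

definition wlen :: "nat \<Rightarrow> word \<Rightarrow> nat" where
  "wlen p w = (LEAST n. \<exists>v. length v = n \<and> eqv p v w)"

definition wdist :: "nat \<Rightarrow> word \<Rightarrow> word \<Rightarrow> nat" where
  "wdist p u v = wlen p (inv_word u @ v)"

definition wpow :: "word \<Rightarrow> nat \<Rightarrow> word" where
  "wpow w n = concat (replicate n w)"

definition infinite_order :: "nat \<Rightarrow> word \<Rightarrow> bool" where
  "infinite_order p g = (\<forall>n>0. \<not> eqv p (wpow g n) [])"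

definition in_cone :: "nat \<Rightarrow> real \<Rightarrow> nat \<Rightarrow> word \<Rightarrow> word \<Rightarrow> bool" where
  "in_cone p \<alpha> c h v =
     (\<exists>n::nat. real (wdist p v (wpow h n)) \<le> \<alpha> * real (wdist p [] (wpow h n)) + real c)"

definition orbit_in_cone :: "nat \<Rightarrow> real \<Rightarrow> nat \<Rightarrow> word \<Rightarrow> word \<Rightarrow> bool" where
  "orbit_in_cone p \<alpha> c g h = (\<forall>m::nat. in_cone p \<alpha> c h (wpow g m))"

definition s_set :: "nat \<Rightarrow> word \<Rightarrow> word \<Rightarrow> real set" where
  "s_set p g h = {\<alpha>. \<alpha> > 0 \<and> (\<exists>c::nat. orbit_in_cone p \<alpha> c g h \<and> orbit_in_cone p \<alpha> c h g)}"

definition s_orb :: "nat \<Rightarrow> word \<Rightarrow> word \<Rightarrow> real" where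
  "s_orb p g h = Inf (s_set p g h)"

definition t_orb :: "nat \<Rightarrow> word \<Rightarrow> word \<Rightarrow> real" where
  "t_orb p g h = sqrt (s_orb p g h)"

end

theory Submission
  imports Defs
begin

text \<open>
  With \<open>b = t\<^sup>-\<^sup>1 a t\<close> the group is an HNN extension of \<open>BS(1,p) = \<langle>a, b | b\<^sup>-\<^sup>1 a b = a\<^sup>p\<rangle>\<close>. By a
  Britton-type argument a shortest word for \<open>a\<^sup>n\<close> amounts to writing \<open>n\<close> as a signed sum of
  powers \<open>p\<^sup>e\<close> and paying for a closed walk on the integers that starts at 0 and visits every
  exponent \<open>e\<close> used, where a step by \<open>y\<close> costs the length of \<open>a\<^sup>y\<close> plus 2.
  Hence \<open>|a\<^sup>N|\<close> is about \<open>2 |a\<^sup>s|\<close> for \<open>N = p\<^sup>s\<close>, whereas for \<open>m\<close> of order \<open>p\<^sup>r\<close>, with \<open>r\<close> well below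
  \<open>s\<close>, the walk for \<open>N - m\<close> has to pass close to both \<open>s\<close> and \<open>r\<close>, so that \<open>|a\<^sup>N\<^sup>-\<^sup>m|\<close> is at least about
  \<open>|a\<^sup>s| + |a\<^sup>r| + |a\<^sup>s\<^sup>-\<^sup>r|\<close>. Given \<open>m\<close> between two consecutive towers of \<open>p\<close>'s with top exponent 1,
  take for \<open>N\<close> the next tower with top exponent 2. Then \<open>s - r\<close> is a difference of the same kind
  one level down, with \<open>|a\<^sup>s| \<ge> 14 \<cdot> 2\<^sup>k\<close> and \<open>|a\<^sup>r| \<ge> 6 \<cdot> 2\<^sup>k\<close> up to constants, and
  \<open>14 + 6 + 14 \<cdot> 17/12 > 2 \<cdot> 14 \<cdot> 17/12\<close> propagates the ratio 17/12 by induction.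
  As \<open>d(a\<^sup>m, a\<^sup>-\<^sup>n) = |a\<^sup>m\<^sup>+\<^sup>n|\<close>, the choice \<open>n = N - m\<close> proves the bound.
\<close>

lemma wpow_singleton: "wpow [x] n = replicate n x"
  by (induction n) (simp_all add: wpow_def)

context
  fixes p :: nat
  assumes p20: "p \<ge> 20"
begin

section \<open>Affine model of \<open>BS(1,p)\<close> and its cosets\<close>

type_synonym aff = "real \<times> int"

text \<open>The pair \<open>(u, k)\<close> is the map \<open>x \<mapsto> u + p\<^sup>k x\<close>. Here \<open>a\<close> is \<open>(1, 0)\<close> and \<open>b\<close> is \<open>(0, -1)\<close>, so that
  conjugation by \<open>t\<close> exchanges \<open>(y, 0)\<close> and \<open>(0, -y)\<close>. The subgroup moved past the letter \<open>(T, b)\<close>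
  is the range of \<open>emb b\<close>.\<close>

definition amul :: "aff \<Rightarrow> aff \<Rightarrow> aff" where
  "amul g h = (fst g + fst h * real p powi snd g, snd g + snd h)"

definition emb :: "bool \<Rightarrow> int \<Rightarrow> aff" where
  "emb b s = (if b then (0, s) else (of_int s, 0))"

text \<open>Multiplying \<open>(u, k)\<close> by \<open>emb False s\<close> adds \<open>s\<close>
  multiples of \<open>p^k\<close> to \<open>u\<close>, so the integer part is taken after rescaling
  by \<open>p^(-k)\<close>.\<close>

definition coset_part :: "bool \<Rightarrow> aff \<Rightarrow> int" where
  "coset_part b g = (if b then snd g else \<lfloor>fst g * real p powi (- snd g)\<rfloor>)"

definition coset_rep :: "bool \<Rightarrow> aff \<Rightarrow> aff" where
  "coset_rep b g = amul g (emb b (- coset_part b g))"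

lemma amul_assoc: "amul (amul g h) k = amul g (amul h k)"
  using p20 by (simp add: amul_def power_int_add algebra_simps)

lemma amul_one [simp]: "amul g (0, 0) = g" "amul (0, 0) g = g"
  by (simp_all add: amul_def)

lemma emb_add: "amul (emb b s) (emb b s') = emb b (s + s')"
  by (simp add: amul_def emb_def)

lemma emb_zero [simp]: "emb b 0 = (0, 0)"
  by (simp add: emb_def)

lemma amul_emb_emb: "amul (amul g (emb b s)) (emb b s') = amul g (emb b (s + s'))"
  by (simp add: amul_assoc emb_add)

lemma coset_rep_part: "amul (coset_rep b g) (emb b (coset_part b g)) = g"
  by (simp add: coset_rep_def amul_emb_emb)

lemma coset_part_mult: "coset_part b (amul g (emb b s)) = coset_part b g + s"
proof (cases b)
  case False
  have "real p powi snd g * real p powi (- snd g) = 1"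
    using p20 by (simp add: power_int_minus)
  then show ?thesis using False
    by (simp add: coset_part_def amul_def emb_def distrib_right mult.assoc)
qed (simp add: coset_part_def amul_def emb_def)

lemma coset_rep_mult: "coset_rep b (amul g (emb b s)) = coset_rep b g"
  by (simp add: coset_rep_def coset_part_mult amul_emb_emb)

lemma coset_rep_idem: "coset_rep b (coset_rep b g) = coset_rep b g"
  by (subst (2) coset_rep_def) (rule coset_rep_mult)

lemma coset_part_rep:
  assumes "coset_rep b r = r" shows "coset_part b r = 0"
proof -
  have "amul r (emb b (- coset_part b r)) = r" using assms by (simp add: coset_rep_def)
  then show ?thesis using p20 by (auto simp: amul_def emb_def prod_eq_iff split: if_splits)
qed

section \<open>Action of words on normal forms of the HNN extension\<close>

text \<open>A state \<open>(g, [(c\<^sub>j, r\<^sub>j), \<dots>, (c\<^sub>1, r\<^sub>1)])\<close> encodes the normal form \<open>r\<^sub>1 t\<^sup>\<plusminus>\<^sup>1 \<dots> r\<^sub>j t\<^sup>\<plusminus>\<^sup>1 g\<close>.\<close>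

type_synonym state = "aff \<times> (bool \<times> aff) list"

text \<open>Right multiplication by a stable letter: the \<open>emb b\<close> part of the last
  segment passes it, which exchanges the two subgroups and flips the sign. The first branch is
  Britton's pinch.\<close>

fun turn :: "bool \<Rightarrow> state \<Rightarrow> state" where
  "turn b (g, L) =
     (if coset_rep b g = (0, 0) \<and> L \<noteq> [] \<and> fst (hd L) = (\<not> b)
      then (amul (snd (hd L)) (emb (\<not> b) (- coset_part b g)), tl L)
      else (emb (\<not> b) (- coset_part b g), (b, coset_rep b g) # L))"

fun act :: "letter \<Rightarrow> state \<Rightarrow> state" where
  "act (A, b) (g, L) = (amul g (emb False (if b then -1 else 1)), L)"
| "act (T, b) \<sigma> = turn b \<sigma>"

abbreviation run :: "word \<Rightarrow> state \<Rightarrow> state" where "run \<equiv> fold act"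

fun reduced :: "(bool \<times> aff) list \<Rightarrow> bool" where
  "reduced [] = True"
| "reduced ((b, r) # L) \<longleftrightarrow>
     coset_rep b r = r \<and> (r = (0, 0) \<longrightarrow> L = [] \<or> fst (hd L) \<noteq> (\<not> b)) \<and> reduced L"

lemma reduced_act: "reduced (snd \<sigma>) \<Longrightarrow> reduced (snd (act x \<sigma>))"
  by (cases x; cases \<sigma>; cases "fst x"; cases "snd \<sigma>") (auto simp: coset_rep_idem)

lemma reduced_run: "reduced (snd \<sigma>) \<Longrightarrow> reduced (snd (run w \<sigma>))"
  by (induction w arbitrary: \<sigma>) (auto simp: reduced_act)

lemma coset_rep_emb: "coset_rep b (emb b s) = (0, 0)"
  using coset_rep_mult[of b "(0,0)" s] by (simp add: coset_rep_def coset_part_def emb_def)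

lemma coset_part_emb: "coset_part b (emb b s) = s"
  using coset_part_mult[of b "(0,0)" s] by (simp add: coset_part_def)

lemma turn_pop:
  "coset_rep b g = (0, 0) \<Longrightarrow>
    turn b (g, (\<not> b, r) # L) = (amul r (emb (\<not> b) (- coset_part b g)), L)"
  by simp

lemma turn_push:
  "coset_rep b g = (0, 0) \<longrightarrow> L = [] \<or> fst (hd L) \<noteq> (\<not> b) \<Longrightarrow>
    turn b (g, L) = (emb (\<not> b) (- coset_part b g), (b, coset_rep b g) # L)"
  by auto

declare turn.simps [simp del]

text \<open>\<open>coset_part\<close> absorbs \<open>s\<close> and \<open>coset_rep\<close> ignores
  it, so the second turn undoes the push or pop of the first; reducedness excludes two pops in a
  row. The case \<open>s = 0\<close> is cancellation of stable letters, \<open>s = 1\<close> and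
  \<open>s = -1\<close> give the action of \<open>b\<close>.\<close>

lemma amul_turn:
  assumes "reduced L"
  shows "turn (\<not> b) (apfst (\<lambda>h. amul h (emb (\<not> b) s)) (turn b (g, L))) = (amul g (emb b (- s)), L)"
proof (cases "coset_rep b g = (0, 0) \<and> L \<noteq> [] \<and> fst (hd L) = (\<not> b)")
  case True
  then obtain r M where L: "L = (\<not> b, r) # M" by (cases L) auto
  have r: "coset_rep (\<not> b) r = r" using assms L by simp
  have 1: "turn b (g, L) = (amul r (emb (\<not> b) (- coset_part b g)), M)"
    unfolding L by (rule turn_pop) (use True in blast)
  have "turn (\<not> b) (amul r (emb (\<not> b) (s - coset_part b g)), M) =
      (emb b (coset_part b g - s), (\<not> b, r) # M)"
    by (subst turn_push) (use assms L in \<open>auto simp: coset_rep_mult r coset_part_mult coset_part_rep\<close>)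
  moreover have "emb b (coset_part b g - s) = amul g (emb b (- s))"
    using coset_rep_part[of b g] emb_add[of b "coset_part b g" "- s"] True by simp
  ultimately show ?thesis by (simp add: 1[unfolded L] amul_emb_emb L)
next
  case False
  then have 1: "turn b (g, L) = (emb (\<not> b) (- coset_part b g), (b, coset_rep b g) # L)"
    by (intro turn_push) blast
  have "turn (\<not> b) (emb (\<not> b) (s - coset_part b g), (b, coset_rep b g) # L) =
      (amul (coset_rep b g) (emb b (coset_part b g - s)), L)"
    using turn_pop[of "\<not> b" "emb (\<not> b) (s - coset_part b g)"] by (simp add: coset_rep_emb coset_part_emb)
  moreover have "amul (coset_rep b g) (emb b (coset_part b g - s)) = amul g (emb b (- s))"
    by (simp add: coset_rep_def amul_emb_emb)
  ultimately show ?thesis by (simp add: 1 emb_add)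
qed

lemma act_inv:
  assumes "reduced (snd \<sigma>)"
  shows "act (inv_letter x) (act x \<sigma>) = \<sigma>"
proof -
  obtain y b where x: "x = (y, b)" by (cases x)
  obtain g L where s: "\<sigma> = (g, L)" by (cases \<sigma>)
  show ?thesis
  proof (cases y)
    case A
    then show ?thesis using x s by (auto simp: amul_emb_emb)
  next
    case T
    have "apfst (\<lambda>h::aff. h) = (id :: state \<Rightarrow> state)" by (auto simp: fun_eq_iff)
    with T amul_turn[of L b 0 g] assms x s show ?thesis by simp
  qed
qed

lemma run_conj:
  assumes "reduced L"
  shows "run [(T,True),(A,b),(T,False)] (g, L) = (amul g (emb True (if b then 1 else -1)), L)"
proof -
  have "act (A, b) \<tau> = apfst (\<lambda>h. amul h (emb False (if b then -1 else 1))) \<tau>" for \<tau>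
    by (cases \<tau>) auto
  then show ?thesis using amul_turn[OF assms, of True "if b then -1 else 1" g]
    by (cases b) simp_all
qed

lemma run_power: "run (replicate n (A, b)) (g, L) = (amul g (emb False (if b then - int n else int n)), L)"
  by (induction n arbitrary: g) (auto simp: amul_emb_emb)

lemma run_relator:
  assumes "reduced (snd \<sigma>)"
  shows "run (relator p) \<sigma> = \<sigma>"
proof -
  obtain g L where s: "\<sigma> = (g, L)" by (cases \<sigma>)
  have r: "reduced L" using assms s by simp
  have "relator p = [(T,True),(A,True),(T,False)] @ [(A,False)] @ [(T,True),(A,False),(T,False)]
      @ replicate p (A,True)" by (simp add: relator_def)
  then have "run (relator p) (g, L) = run (replicate p (A, True))
      (run [(T,True),(A,False),(T,False)] (run [(A,False)] (run [(T,True),(A,True),(T,False)] (g, L))))"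
    by simp
  also have "run [(T,True),(A,True),(T,False)] (g, L) = (amul g (emb True 1), L)"
    using run_conj[OF r, of True g] by simp
  also have "run [(A,False)] (amul g (emb True 1), L) = (amul (amul g (emb True 1)) (emb False 1), L)"
    by simp
  also have "run [(T,True),(A,False),(T,False)] (amul (amul g (emb True 1)) (emb False 1), L) =
      (amul (amul (amul g (emb True 1)) (emb False 1)) (emb True (-1)), L)"
    using run_conj[OF r, of False "amul (amul g (emb True 1)) (emb False 1)"] by simp
  also have "run (replicate p (A, True)) \<dots> =
      (amul (amul (amul (amul g (emb True 1)) (emb False 1)) (emb True (-1))) (emb False (- int p)), L)"
    by (simp only: run_power if_True)
  also have "amul (amul (amul (amul g (emb True 1)) (emb False 1)) (emb True (-1)))
      (emb False (- int p)) = g"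
    using p20 by (simp add: amul_def emb_def power_int_add prod_eq_iff)
  finally show ?thesis by (simp add: s)
qed

lemma eqv_run:
  "eqv p u v \<Longrightarrow> reduced (snd \<sigma>) \<Longrightarrow> run u \<sigma> = run v \<sigma>"
proof (induction arbitrary: \<sigma> rule: eqv.induct)
  case (eqv_cancel u x v)
  then show ?case by (simp add: act_inv reduced_run del: inv_letter.simps)
next
  case (eqv_rel u v)
  then show ?case by (simp add: run_relator reduced_run)
qed auto

section \<open>Cost of elements of \<open>BS(1,p)\<close>\<close>

text \<open>Elements are built from letters \<open>a\<close> and blocks \<open>b^y\<close>. A block
  is spelled \<open>t^-1 a^y t\<close>, so its price is recursively that of \<open>a^y\<close> plus
  2. The base rule admits every \<open>l\<close>, which makes the predicate upward closed.\<close>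

inductive reach :: "aff \<Rightarrow> nat \<Rightarrow> bool" where
  reach_one: "reach (0, 0) l"
| reach_a: "reach (u, k) l \<Longrightarrow> \<bar>\<sigma>\<bar> = 1 \<Longrightarrow> reach (u + \<sigma> * real p powi k, k) (Suc l)"
| reach_b: "reach (u, k) l \<Longrightarrow> reach (of_int y, 0) l' \<Longrightarrow> reach (u, k - y) (l + l' + 2)"

lemma reach_mono: "reach g l \<Longrightarrow> l \<le> l' \<Longrightarrow> reach g l'"
proof (induction arbitrary: l' rule: reach.induct)
  case (reach_a u k l \<sigma>)
  then obtain j where "l' = Suc j" "l \<le> j" by (cases l') auto
  then show ?case using reach_a reach.reach_a by blast
next
  case (reach_b u k l y m)
  then have "reach (u, k) (l' - m - 2)" "l' = (l' - m - 2) + m + 2" by auto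
  then show ?case using reach_b.hyps(2) reach.reach_b by metis
qed (rule reach_one)

lemma reach_amul: "reach h l' \<Longrightarrow> reach g l \<Longrightarrow> reach (amul g h) (l + l')"
proof (induction rule: reach.induct)
  case (reach_one l')
  then show ?case using reach_mono by simp
next
  case (reach_a u k l' \<sigma>)
  then have "reach (amul g (u, k)) (l + l')" by blast
  then have "reach (fst g + u * real p powi snd g + \<sigma> * real p powi (snd g + k), snd g + k) (Suc (l + l'))"
    using reach.reach_a[of _ "snd g + k" "l + l'" \<sigma>] reach_a(2) by (simp add: amul_def)
  then show ?case using p20 by (simp add: amul_def power_int_add algebra_simps)
next
  case (reach_b u k l1 y l2)
  then have "reach (amul g (u, k)) (l + l1)" by blast
  then have "reach (fst g + u * real p powi snd g, snd g + k - y) (l + l1 + l2 + 2)"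
    using reach.reach_b reach_b.hyps(2) by (simp add: amul_def)
  then show ?case by (simp add: amul_def algebra_simps)
qed

lemma reach_gen: "\<bar>\<sigma>\<bar> = 1 \<Longrightarrow> reach (\<sigma>, 0) 1"
  using reach_a[OF reach_one, of \<sigma> 0] by simp

lemma reach_swap_a: "reach (of_int y, 0) l \<Longrightarrow> reach (0, - y) (l + 2)"
  using reach_b[OF reach_one, of y l 0] by simp

lemma reach_inv: "reach g l \<Longrightarrow> reach (- fst g * real p powi (- snd g), - snd g) l"
proof (induction rule: reach.induct)
  case (reach_a u k l \<sigma>)
  have "reach (amul (- \<sigma>, 0) (- u * real p powi (- k), - k)) (1 + l)"
    using reach_amul[OF reach_a.IH reach_gen[of "- \<sigma>"]] reach_a(2) by simp
  moreover have "real p powi k * real p powi - k = 1" using p20 by (simp add: power_int_minus)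
  then have "amul (- \<sigma>, 0) (- u * real p powi (- k), - k) =
      (- (u + \<sigma> * real p powi k) * real p powi - k, - k)"
    by (simp add: amul_def algebra_simps)
  ultimately show ?case by simp
next
  case (reach_b u k l y l')
  have y: "reach (0, y) (l' + 2)" using reach_swap_a[of "- y" l'] reach_b.IH(2) by simp
  have "reach (amul (0, y) (- u * real p powi (- k), - k)) (l' + 2 + l)"
    using reach_amul[OF reach_b.IH(1) y] by simp
  moreover have "real p powi y * real p powi - k = real p powi (y - k)"
    using p20 power_int_add[of "real p" y "- k"] by simp
  ultimately show ?case by (simp add: amul_def algebra_simps)
qed (simp add: reach_one)

text \<open>Conjugating a \<open>b\<close>-power back to an \<open>a\<close>-power inside a \<open>t (\<dots>) t\<^sup>-\<^sup>1\<close> block never pays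
  off, which is why \<open>reach\<close> needs no rule for such blocks.\<close>

lemma reach_exponent: "reach g l \<Longrightarrow> reach (of_int (snd g), 0) l"
proof (induction rule: reach.induct)
  case (reach_a u k l \<sigma>)
  then show ?case using reach_mono[of _ l "Suc l"] by simp
next
  case (reach_b u k l y l')
  have "reach (- of_int y, 0) l'" using reach_inv[OF reach_b.hyps(2)] by simp
  from reach_amul[OF this reach_b.IH(1)] reach_mono show ?case by (simp add: amul_def)
qed (simp add: reach_one)

text \<open>The 2 pays for two stable letters. From \<open>a\<close> to \<open>b\<close> this is a
  block; the other direction is covered by \<open>reach_exponent\<close>.\<close>

lemma reach_swap: "reach (emb b s) l \<Longrightarrow> reach (emb (\<not> b) (- s)) (l + 2)"
proof (cases b)
  case True
  assume "reach (emb b s) l"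
  then have "reach (of_int s, 0) l" using reach_exponent True by (fastforce simp: emb_def)
  then have "reach (- of_int s, 0) l" using reach_inv by fastforce
  then show ?thesis using reach_mono[of _ l "l + 2"] True by (simp add: emb_def)
qed (use reach_swap_a[of s l] in \<open>simp add: emb_def\<close>)

text \<open>The potential of a state: the letters read so far are distributed over the segments of the
  normal form, which are only correct up to the elements \<open>s\<close> that were moved past a stable letter.\<close>

fun weighted :: "nat \<Rightarrow> aff \<Rightarrow> (bool \<times> aff) list \<Rightarrow> bool" where
  "weighted l g [] = reach g l"
| "weighted l g ((b, r) # L) = (\<exists>s h l1 l2. g = amul (emb (\<not> b) (- s)) h \<and> reach h l2
      \<and> weighted l1 (amul r (emb b s)) L \<and> l = l1 + 1 + l2)"

lemma weighted_amul:
  assumes "weighted l g L" "reach h m"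
  shows "weighted (l + m) (amul g h) L"
proof (cases L)
  case Nil
  then show ?thesis using assms reach_amul by simp
next
  case (Cons e L')
  obtain b r where e: "e = (b, r)" by (cases e)
  from assms Cons e obtain s k l1 l2 where
    *: "g = amul (emb (\<not> b) (- s)) k" "reach k l2" "weighted l1 (amul r (emb b s)) L'" "l = l1 + 1 + l2"
    by auto
  have "amul g h = amul (emb (\<not> b) (- s)) (amul k h)" using * amul_assoc by simp
  moreover have "reach (amul k h) (l2 + m)" using reach_amul * assms by blast
  moreover have "l + m = l1 + 1 + (l2 + m)" using * by simp
  ultimately show ?thesis using * unfolding Cons e weighted.simps by blast
qed

lemma amul_left_cancel: "amul g h = amul g k \<Longrightarrow> h = k"
  using p20 by (auto simp: amul_def prod_eq_iff)

text \<open>In a pinch, left cancellation forces the open segment into the range of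
  \<open>emb b\<close>, and \<open>reach_swap\<close> carries it across for 2, the price of the two
  stable letters that cancel. A push opens an empty segment of cost 0.\<close>

lemma weighted_turn:
  assumes "weighted l g L"
  shows "weighted (Suc l) (fst (turn b (g, L))) (snd (turn b (g, L)))"
proof (cases "coset_rep b g = (0, 0) \<and> L \<noteq> [] \<and> fst (hd L) = (\<not> b)")
  case True
  then obtain r M where L: "L = (\<not> b, r) # M" by (cases L) auto
  have g: "emb b (coset_part b g) = g" using True coset_rep_part[of b g] by simp
  from assms L obtain s h l1 l2 where
    *: "g = amul (emb b (- s)) h" "reach h l2" "weighted l1 (amul r (emb (\<not> b) s)) M" "l = l1 + 1 + l2"
    by auto
  have "amul (emb b (- s)) h = amul (emb b (- s)) (emb b (s + coset_part b g))"
    using g * by (simp add: emb_add)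
  then have h: "h = emb b (s + coset_part b g)" by (rule amul_left_cancel)
  then have "reach (emb (\<not> b) (- (s + coset_part b g))) (l2 + 2)"
    using * reach_swap by blast
  from weighted_amul[OF *(3) this]
  have "weighted (l1 + (l2 + 2)) (amul r (emb (\<not> b) (- coset_part b g))) M"
    by (simp add: amul_emb_emb)
  moreover have "turn b (g, L) = (amul r (emb (\<not> b) (- coset_part b g)), M)"
    unfolding L by (rule turn_pop) (use True in blast)
  ultimately show ?thesis using * by simp
next
  case False
  then have 1: "turn b (g, L) = (emb (\<not> b) (- coset_part b g), (b, coset_rep b g) # L)"
    by (intro turn_push) blast
  have "weighted l (amul (coset_rep b g) (emb b (coset_part b g))) L"
    using assms by (simp add: coset_rep_part)
  moreover have "emb (\<not> b) (- coset_part b g) = amul (emb (\<not> b) (- coset_part b g)) (0, 0)"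
    by simp
  ultimately show ?thesis unfolding 1 fst_conv snd_conv weighted.simps
    using reach_one[of 0] by (metis Suc_eq_plus1 add_0_right)
qed

lemma weighted_act: "weighted l (fst \<sigma>) (snd \<sigma>) \<Longrightarrow> weighted (Suc l) (fst (act x \<sigma>)) (snd (act x \<sigma>))"
proof -
  assume w: "weighted l (fst \<sigma>) (snd \<sigma>)"
  obtain y b where x: "x = (y, b)" by (cases x)
  obtain g L where s: "\<sigma> = (g, L)" by (cases \<sigma>)
  show ?thesis
  proof (cases y)
    case A
    have "reach (emb False (if b then -1 else 1)) 1" using reach_gen[of 1] reach_gen[of "- 1"] by (simp add: emb_def)
    with weighted_amul[of l g L _ 1] w show ?thesis by (simp add: A x s)
  next
    case T
    then show ?thesis using weighted_turn w by (simp add: x s)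
  qed
qed

lemma weighted_run:
  "weighted l (fst \<sigma>) (snd \<sigma>) \<Longrightarrow> weighted (l + length w) (fst (run w \<sigma>)) (snd (run w \<sigma>))"
proof (induction w arbitrary: l \<sigma>)
  case (Cons x w)
  from Cons.IH[OF weighted_act[OF Cons.prems]] show ?case by simp
qed simp

text \<open>The normal form of a power of \<open>a\<close> has no stable letters, so at the end of
  the run the potential is \<open>reach\<close> itself.\<close>

lemma eqv_power_reach:
  assumes "eqv p v (replicate n (A, b))"
  shows "reach (of_int (if b then - int n else int n), 0) (length v)"
proof -
  have "run v ((0, 0), []) = (emb False (if b then - int n else int n), [])"
    using eqv_run[OF assms, of "((0, 0), [])"] run_power[of n b "(0, 0)"] by simp
  with weighted_run[of 0 "((0, 0), [])" v] show ?thesis by (simp add: reach_one emb_def)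
qed

lemma power_a_nontrivial:
  assumes "eqv p (replicate n (A, False)) []" shows "n = 0"
  using eqv_run[OF assms, of "((0, 0), [])"] run_power[of n False "(0, 0)"] by (simp add: emb_def)

section \<open>Length function on powers of \<open>a\<close>\<close>

definition alen :: "int \<Rightarrow> nat" where
  "alen n = (LEAST l. reach (of_int n, 0) l)"

lemma reach_of_nat: "reach (of_nat n, 0) n"
proof (induction n)
  case (Suc n)
  from reach_a[OF this, of 1] show ?case by (simp add: add.commute)
qed (simp add: reach_one)

lemma reach_of_int: "reach (of_int n, 0) (nat \<bar>n\<bar>)"
  using reach_of_nat[of "nat \<bar>n\<bar>"] reach_inv[OF reach_of_nat[of "nat \<bar>n\<bar>"]]
  by (cases "n \<ge> 0") auto

lemma reach_alen: "reach (of_int n, 0) (alen n)"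
  unfolding alen_def by (rule LeastI) (rule reach_of_int)

lemma alen_le: "reach (of_int n, 0) l \<Longrightarrow> alen n \<le> l"
  unfolding alen_def by (rule Least_le)

lemma alen_zero [simp]: "alen 0 = 0"
  using alen_le[of 0 0] reach_one by simp

lemma alen_add: "alen (m + n) \<le> alen m + alen n"
  by (rule alen_le) (use reach_amul[OF reach_alen[of n] reach_alen[of m]] in \<open>simp add: amul_def\<close>)

lemma alen_minus [simp]: "alen (- n) = alen n"
proof -
  have "alen (- n) \<le> alen n" for n
    by (rule alen_le) (use reach_inv[OF reach_alen[of n]] in simp)
  from this[of n] this[of "- n"] show ?thesis by simp
qed

lemma alen_abs [simp]: "alen \<bar>n\<bar> = alen n"
  by (simp add: abs_if)

lemma alen_lipschitz: "alen m \<le> alen n + nat \<bar>m - n\<bar>"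
  using alen_add[of n "m - n"] alen_le[OF reach_of_int[of "m - n"]] by simp

definition shift_cost :: "int \<Rightarrow> nat" where
  "shift_cost y = (if y = 0 then 0 else alen y + 2)"

lemma shift_cost_zero [simp]: "shift_cost 0 = 0" by (simp add: shift_cost_def)

lemma shift_cost_minus [simp]: "shift_cost (- y) = shift_cost y" by (simp add: shift_cost_def)

lemma shift_cost_add: "shift_cost (x + y) \<le> shift_cost x + shift_cost y"
  using alen_add[of x y] by (auto simp: shift_cost_def)

lemma alen_le_shift_cost: "alen y \<le> shift_cost y" by (simp add: shift_cost_def)

section \<open>Walks through the exponents\<close>

definition tour :: "int \<Rightarrow> int \<Rightarrow> int \<Rightarrow> nat" where
  "tour e e' k = shift_cost e + shift_cost (e' - e) + shift_cost (k - e')"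

definition psum :: "(real \<times> int) list \<Rightarrow> real" where
  "psum ps = (\<Sum>(\<sigma>, e)\<leftarrow>ps. \<sigma> * real p powi e)"

lemma psum_simps [simp]:
  "psum [] = 0" "psum ((\<sigma>, e) # ps) = \<sigma> * real p powi e + psum ps"
  by (simp_all add: psum_def)

abbreviation units :: "(real \<times> int) list \<Rightarrow> bool" where
  "units ps \<equiv> \<forall>x\<in>set ps. \<bar>fst x\<bar> = 1"

abbreviation levels :: "(real \<times> int) list \<Rightarrow> int set" where
  "levels ps \<equiv> snd ` set ps"

lemma tour_shift: "tour e e' (k - y) \<le> tour e e' k + shift_cost y"
  using shift_cost_add[of "k - e'" "- y"] by (simp add: tour_def algebra_simps)

text \<open>Each letter \<open>a\<close> read at exponent \<open>e\<close> contributes a summand of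
  \<open>ps\<close>. The minimum reflects that the walk may visit two levels in either
  order.\<close>

definition traced :: "(real \<times> int) list \<Rightarrow> aff \<Rightarrow> nat \<Rightarrow> bool" where
  "traced ps g l \<longleftrightarrow> fst g = psum ps \<and> units ps \<and> shift_cost (snd g) + length ps \<le> l \<and>
     (\<forall>e e'. e \<in> levels ps \<longrightarrow> e' \<in> levels ps \<longrightarrow>
        min (tour e e' (snd g)) (tour e' e (snd g)) + length ps \<le> l)"

lemma tracedI:
  assumes "u = psum ps" "units ps" "shift_cost k + length ps \<le> l"
    "\<And>e e'. e \<in> levels ps \<Longrightarrow> e' \<in> levels ps \<Longrightarrow> min (tour e e' k) (tour e' e k) + length ps \<le> l"
  shows "traced ps (u, k) l"
  unfolding traced_def fst_conv snd_conv using assms by blast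

lemma tracedD:
  assumes "traced ps (u, k) l"
  shows "u = psum ps" "units ps" "shift_cost k + length ps \<le> l"
    "\<And>e e'. e \<in> levels ps \<Longrightarrow> e' \<in> levels ps \<Longrightarrow> min (tour e e' k) (tour e' e k) + length ps \<le> l"
  using assms unfolding traced_def fst_conv snd_conv by blast+

text \<open>A letter is added at the current end \<open>k\<close> of the walk, so a pair involving
  \<open>k\<close> reduces to a tour through the other level alone; a block lengthens a tour by at
  most \<open>shift_cost y\<close>.\<close>

lemma reach_traced: "reach g l \<Longrightarrow> \<exists>ps. traced ps g l"
proof (induction rule: reach.induct)
  case (reach_one l)
  show ?case by (rule exI[of _ "[]"], rule tracedI) simp_all
next
  case (reach_a u k l \<sigma>)
  from reach_a.IH obtain ps where "traced ps (u, k) l" by blast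
  note ps = tracedD(1-3)[OF this] and t = tracedD(4)[OF this]
  have t1: "tour e k k + length ps \<le> l" if "e \<in> levels ps" for e
    using t[OF that that] by (simp add: tour_def)
  have t2: "tour k k k + length ps \<le> l"
    using ps(3) by (simp add: tour_def)
  have "min (tour e e' k) (tour e' e k) + length ((\<sigma>, k) # ps) \<le> Suc l"
    if "e \<in> levels ((\<sigma>, k) # ps)" "e' \<in> levels ((\<sigma>, k) # ps)" for e e'
  proof -
    from that consider "e \<in> levels ps" "e' \<in> levels ps" | "e = k" "e' = k"
      | "e = k" "e' \<in> levels ps" | "e' = k" "e \<in> levels ps" by auto
    then show ?thesis
    proof cases
      case 1
      from t[OF this] show ?thesis by simp
    next
      case 2
      with t2 show ?thesis by simp
    next
      case 3
      with t1[of e'] show ?thesis by simp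
    next
      case 4
      with t1[of e] show ?thesis by simp
    qed
  qed
  then have "traced ((\<sigma>, k) # ps) (u + \<sigma> * real p powi k, k) (Suc l)"
    using ps reach_a(2) by (intro tracedI) simp_all
  then show ?case by blast
next
  case (reach_b u k l y l')
  from reach_b.IH(1) obtain ps where "traced ps (u, k) l" by blast
  note ps = tracedD(1-3)[OF this] and t = tracedD(4)[OF this]
  have y: "shift_cost y \<le> l' + 2" using alen_le[OF reach_b.hyps(2)] by (simp add: shift_cost_def)
  have "min (tour e e' (k - y)) (tour e' e (k - y)) + length ps \<le> l + l' + 2"
    if "e \<in> levels ps" "e' \<in> levels ps" for e e'
    using t[OF that] tour_shift[of e e' k y] tour_shift[of e' e k y] y by linarith
  moreover have "shift_cost (k - y) + length ps \<le> l + l' + 2"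
    using shift_cost_add[of k "- y"] ps(3) y by simp
  ultimately have "traced ps (u, k - y) (l + l' + 2)"
    using ps by (intro tracedI)
  then show ?case by blast
qed

definition optimal :: "(real \<times> int) list \<Rightarrow> int \<Rightarrow> bool" where
  "optimal ps n \<longleftrightarrow> of_int n = psum ps \<and> units ps \<and> length ps \<le> alen n \<and>
     (\<forall>e e'. e \<in> levels ps \<longrightarrow> e' \<in> levels ps \<longrightarrow>
        shift_cost e + shift_cost (e' - e) + shift_cost e' + length ps \<le> alen n)"

lemma optimalD:
  assumes "optimal ps n"
  shows "of_int n = psum ps" "units ps" "length ps \<le> alen n"
    "\<And>e e'. e \<in> levels ps \<Longrightarrow> e' \<in> levels ps \<Longrightarrow>
        shift_cost e + shift_cost (e' - e) + shift_cost e' + length ps \<le> alen n"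
  using assms unfolding optimal_def by blast+

text \<open>The walk for a power of \<open>a\<close> ends at exponent 0, so both orders cost the
  same and the minimum in \<open>traced\<close> disappears.\<close>

lemma ex_optimal: "\<exists>ps. optimal ps n"
proof -
  obtain ps where "traced ps (of_int n, 0) (alen n)" using reach_traced[OF reach_alen[of n]] by blast
  note ps = tracedD(1-3)[OF this] and t = tracedD(4)[OF this]
  have tour: "tour e e' 0 = shift_cost e + shift_cost (e' - e) + shift_cost e'" for e e'
    by (simp add: tour_def)
  have "tour e' e 0 = tour e e' 0" for e e'
    using shift_cost_minus[of "e - e'"] unfolding tour by simp
  then have "tour e e' 0 + length ps \<le> alen n" if "e \<in> levels ps" "e' \<in> levels ps" for e e'
    using t[OF that] by (metis min.idem)
  then have "optimal ps n" using ps unfolding optimal_def tour by simp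
  then show ?thesis by blast
qed

section \<open>Sizes of signed sums of powers of \<open>p\<close>\<close>

lemma psum_le:
  fixes B :: real
  assumes "units ps" "\<And>e. e \<in> levels ps \<Longrightarrow> real p powi e \<le> B"
  shows "\<bar>psum ps\<bar> \<le> length ps * B"
  using assms
proof (induction ps)
  case (Cons x ps)
  obtain \<sigma> e where x: "x = (\<sigma>, e)" by (cases x)
  have "\<bar>psum (x # ps)\<bar> \<le> \<bar>\<sigma> * real p powi e\<bar> + \<bar>psum ps\<bar>" by (simp add: x)
  also have "\<bar>\<sigma> * real p powi e\<bar> = real p powi e" using Cons.prems(1) by (simp add: x abs_mult)
  also have "real p powi e + \<bar>psum ps\<bar> \<le> B + length ps * B"
    using Cons by (intro add_mono) (simp_all add: x)
  finally show ?case by (simp add: algebra_simps)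
qed simp

text \<open>If no level lies strictly between \<open>a\<close> and \<open>b\<close>, the high part of the sum is an integer
  multiple of \<open>p\<^sup>b\<close> and the low part is tiny.\<close>

lemma psum_gap:
  assumes "units ps" "\<And>e. e \<in> levels ps \<Longrightarrow> e \<le> a \<or> b \<le> e"
  shows "\<bar>psum ps\<bar> \<le> length ps * real p powi a \<or>
         real p powi b - length ps * real p powi a \<le> \<bar>psum ps\<bar>"
proof -
  have "\<exists>z::int. \<bar>psum ps - z * real p powi b\<bar> \<le> length ps * real p powi a"
    using assms
  proof (induction ps)
    case Nil
    show ?case by (rule exI[of _ 0]) simp
  next
    case (Cons x ps)
    obtain \<sigma> e where x: "x = (\<sigma>, e)" by (cases x)
    from Cons obtain z :: int where z: "\<bar>psum ps - z * real p powi b\<bar> \<le> length ps * real p powi a"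
      by auto
    have s: "\<bar>\<sigma>\<bar> = 1" using Cons.prems(1) x by simp
    show ?case
    proof (cases "b \<le> e")
      case True
      obtain \<tau> :: int where \<tau>: "\<sigma> = of_int \<tau>"
        using s that[of 1] that[of "- 1"] by (cases "\<sigma> \<ge> 0") auto
      obtain d where d: "e = int d + b" using True that[of "nat (e - b)"] by simp
      define B where "B = real p powi b"
      have "real p powi e = real p ^ d * B"
        using p20 by (simp add: d power_int_add B_def)
      then have eq: "psum (x # ps) - of_int (z + \<tau> * int p ^ d) * B = psum ps - z * B"
        by (simp add: x \<tau> ring_distribs)
      have "\<bar>psum ps - z * B\<bar> \<le> length ps * real p powi a" using z by (simp only: B_def)
      also have "\<dots> \<le> length (x # ps) * real p powi a"
        by (intro mult_right_mono) simp_all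
      finally have "\<bar>psum (x # ps) - of_int (z + \<tau> * int p ^ d) * B\<bar> \<le> length (x # ps) * real p powi a"
        unfolding eq .
      then show ?thesis unfolding B_def by (rule exI)
    next
      case False
      then have "e \<le> a" using Cons.prems(2)[of e] x by auto
      then have "real p powi e \<le> real p powi a" using p20 by (intro power_int_increasing) auto
      moreover have "\<bar>\<sigma> * real p powi e\<bar> = real p powi e" using s by (simp add: abs_mult)
      ultimately have "\<bar>psum (x # ps) - z * real p powi b\<bar> \<le> length ps * real p powi a + real p powi a"
        using z by (simp add: x)
      also have "\<dots> = length (x # ps) * real p powi a" by (simp add: ring_distribs)
      finally have "\<bar>psum (x # ps) - z * real p powi b\<bar> \<le> length (x # ps) * real p powi a" .
      then show ?thesis by (rule exI[of _ z])
    qed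
  qed
  then obtain z :: int where z: "\<bar>psum ps - z * real p powi b\<bar> \<le> length ps * real p powi a" by blast
  show ?thesis
  proof (cases "z = 0")
    case False
    then have "1 \<le> \<bar>real_of_int z\<bar>" by linarith
    then have "1 * real p powi b \<le> \<bar>real_of_int z\<bar> * real p powi b" by (intro mult_right_mono) simp_all
    then have "real p powi b \<le> \<bar>z * real p powi b\<bar>" by (simp add: abs_mult)
    then show ?thesis using z by linarith
  qed (use z in simp)
qed

section \<open>Lower bounds for lengths at towers\<close>

text \<open>Going to a level \<open>e \<noteq> 0\<close> and back takes
  \<open>2 * (alen e + 2)\<close>, which leaves at most \<open>2 * (M - alen e) + 1\<close>
  summands.\<close>

lemma short_imp_small_step:
  fixes n :: int
  assumes M: "M \<ge> 1" and W: "\<And>x. alen x \<le> M \<Longrightarrow> \<bar>x\<bar> \<le> int W"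
    and n: "alen n \<le> 2 * M + 5"
  shows "\<bar>n\<bar> \<le> int p ^ W"
proof -
  obtain ps where "optimal ps n" using ex_optimal by blast
  note ps = optimalD(1-3)[OF this] and t = optimalD(4)[OF this]
  define X where "X = length ps"
  show ?thesis
  proof (cases "X = 0")
    case True
    then show ?thesis using ps X_def by simp
  next
    case False
    have MW: "M \<le> W"
      using W[of "int M"] alen_le[of "int M" M] reach_of_nat[of M] by simp
    have pow: "2 * m + 5 \<le> p ^ m" if "m \<ge> 1" for m
      using that
    proof (induction m rule: dec_induct)
      case (step m)
      have "2 * Suc m + 5 \<le> 2 * p ^ m" using step by simp
      also have "\<dots> \<le> p ^ Suc m" using p20 by simp
      finally show ?case .
    qed (use p20 in simp)
    have "real p powi e \<le> real p ^ W / X" if e: "e \<in> levels ps" for e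
    proof (cases "e = 0")
      case True
      have "X \<le> 2 * M + 5" using ps(3) n X_def by simp
      also have "\<dots> \<le> p ^ M" using pow M by blast
      also have "\<dots> \<le> p ^ W" using MW p20 by (intro power_increasing) auto
      finally have "real X \<le> real p ^ W" by (metis of_nat_le_iff of_nat_power)
      then show ?thesis using True False by (simp add: field_simps)
    next
      case e0: False
      \<comment> \<open>The \<open>X\<close> summands at \<open>e\<close> weigh at most as much as
        one at \<open>e + j\<close>, since \<open>X \<le> p^j\<close>, and the raised exponent still
        has length at most \<open>M\<close>.\<close>
      define j where "j = X div 2"
      have "2 * alen e + 4 + X \<le> 2 * M + 5" using t[OF e e] n e0 X_def by (simp add: shift_cost_def)
      then have "alen e + j \<le> M" using j_def by linarith
      then have "alen (\<bar>e\<bar> + int j) \<le> M"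
        using alen_lipschitz[of "\<bar>e\<bar> + int j" "\<bar>e\<bar>"] by simp
      then have ej: "e + int j \<le> int W" using W[of "\<bar>e\<bar> + int j"] by linarith
      have "X \<le> p ^ j"
      proof (cases "j = 0")
        case False
        then have "X \<le> 2 * j + 5" using j_def by linarith
        then show ?thesis using pow[of j] False by linarith
      qed (use \<open>X \<noteq> 0\<close> j_def in auto)
      then have "real p powi e * X \<le> real p powi e * real p ^ j"
        by (intro mult_left_mono) (simp_all flip: of_nat_power)
      also have "\<dots> = real p powi (e + int j)" using p20 by (simp add: power_int_add)
      also have "\<dots> \<le> real p powi (int W)" using ej p20 by (intro power_int_increasing) auto
      finally show ?thesis using False by (simp add: field_simps)
    qed
    from psum_le[OF ps(2) this] have "\<bar>real_of_int n\<bar> \<le> real p ^ W" using ps(1) False X_def by simp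
    then show ?thesis by (metis of_int_abs of_int_le_iff of_int_of_nat_eq of_int_power)
  qed
qed

primrec tower :: "nat \<Rightarrow> nat \<Rightarrow> nat" where
  "tower v 0 = v"
| "tower v (Suc k) = p ^ tower v k"

lemma short_imp_small_base:
  assumes "alen n \<le> v" "v \<le> 2"
  shows "\<bar>n\<bar> \<le> int v"
proof -
  obtain ps where "optimal ps n" using ex_optimal by blast
  note ps = optimalD(1-3)[OF this] and t = optimalD(4)[OF this]
  have "real p powi e \<le> 1" if "e \<in> levels ps" for e
    using t[OF that that] assms by (cases "e = 0") (auto simp: shift_cost_def)
  from psum_le[OF ps(2) this] ps(1,3) assms show ?thesis by simp
qed

text \<open>The thresholds \<open>(v + 5) * 2^k - 5\<close> start at \<open>v\<close> and obey the
  recursion \<open>M' = 2 * M + 5\<close> of \<open>short_imp_small_step\<close>.\<close>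

lemma short_imp_small:
  assumes "v \<in> {1, 2}" "alen n + 5 \<le> (v + 5) * 2 ^ k"
  shows "\<bar>n\<bar> \<le> int (tower v k)"
  using assms(2)
proof (induction k arbitrary: n)
  case 0
  then show ?case using short_imp_small_base[of n v] assms(1) by auto
next
  case (Suc k)
  have "6 \<le> (v + 5) * 2 ^ k" using assms(1) mult_le_mono[of 6 "v + 5" 1 "2 ^ k"] by auto
  then show ?case
    using short_imp_small_step[of "(v + 5) * 2 ^ k - 5" "tower v k" n] Suc by auto
qed

lemma alen_ge_tower:
  assumes "v \<in> {1, 2}" "int (tower v k) \<le> n"
  shows "(v + 5) * 2 ^ k \<le> alen n + 5"
proof (rule ccontr)
  assume "\<not> ?thesis"
  \<comment> \<open>Passing to \<open>n + 1\<close> exceeds the tower strictly and costs at most one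
    unit of length.\<close>
  then have "alen (n + 1) + 5 \<le> (v + 5) * 2 ^ k" using alen_lipschitz[of "n + 1" n] by simp
  from short_imp_small[OF assms(1) this] assms(2) show False by simp
qed

section \<open>Lengths of complements of \<open>m\<close> in a tower\<close>

text \<open>If all levels avoid the window around \<open>q\<close>, then \<open>psum_gap\<close>
  puts the sum either below \<open>p^q / 2\<close> or above \<open>p^(q+1)\<close>, because
  \<open>p^g\<close> outweighs the number of summands.\<close>

lemma level_near:
  assumes u: "units ps" and g: "1 \<le> g" "2 * length ps \<le> p ^ g"
    and lo: "real p ^ q / 2 \<le> \<bar>psum ps\<bar>" and hi: "\<bar>psum ps\<bar> < real p ^ Suc q"
  shows "\<exists>e\<in>levels ps. \<bar>e - int q\<bar> \<le> int g"
proof (rule ccontr)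
  assume none: "\<not> ?thesis"
  define Q where "Q = real p powi (int q - 1)"
  have Q: "Q > 0" using p20 by (simp add: Q_def)
  have pw: "real p powi (int q - 1 + int d) = real p ^ d * Q" for d
    using p20 by (simp add: power_int_add[of "real p" "int q - 1" "int d"] Q_def)
  have q: "real p ^ q = real p * Q" "real p ^ Suc q = real p ^ 2 * Q"
    using pw[of 1] pw[of 2] by (simp_all add: power2_eq_square)
  have low: "length ps * real p powi (int q - 1 - int g) \<le> Q / 2"
  proof -
    have "real (2 * length ps) \<le> real (p ^ g)" using g(2) by (rule of_nat_mono)
    then have "2 * (length ps * real p powi (int q - 1 - int g)) \<le> real p ^ g * real p powi (int q - 1 - int g)"
      by (simp add: mult.assoc[symmetric] mult_right_mono)
    also have "\<dots> = Q"
      using p20 by (simp add: Q_def power_int_diff)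
    finally show ?thesis by simp
  qed
  have "real p ^ 3 \<le> real p ^ (g + 2)" using g(1) p20 by (intro power_increasing) auto
  then have "real p ^ 3 * Q \<le> real p powi (int q - 1 + int (g + 2))"
    using Q unfolding pw by simp
  moreover have "2 * (real p ^ 2 * Q) \<le> real p ^ 3 * Q"
  proof -
    have "2 * (real p ^ 2 * Q) \<le> real p * (real p ^ 2 * Q)"
      using Q p20 by (intro mult_right_mono) auto
    then show ?thesis by (simp add: power3_eq_cube power2_eq_square mult.assoc)
  qed
  moreover have "2 * Q \<le> real p * Q" using Q p20 by (intro mult_right_mono) auto
  moreover have "real p * Q \<le> real p ^ 2 * Q"
    using Q p20 by (intro mult_right_mono) (auto simp: power2_eq_square)
  moreover have "e \<le> int q - 1 - int g \<or> int q - 1 + int (g + 2) \<le> e" if "e \<in> levels ps" for e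
    using none that by fastforce
  note psum_gap[OF u this]
  ultimately show False using low lo hi Q unfolding q by linarith
qed

text \<open>\<open>level_near\<close> finds levels of one walk within \<open>g\<close> of
  \<open>s\<close> and of \<open>r\<close>; replacing them by \<open>s\<close> and \<open>r\<close>
  changes the three legs by at most \<open>g\<close>, \<open>g\<close> and
  \<open>2 * g\<close>.\<close>

lemma alen_complement_step:
  fixes m r s g :: nat
  defines "n \<equiv> int (p ^ s) - int m"
  assumes m: "p ^ r \<le> m" "m < p ^ Suc r" and g: "1 \<le> g" "r + g < s" "2 * (alen n + 1) \<le> p ^ g"
  shows "alen (int s) + alen (int s - int r) + alen (int r) \<le> alen n + 4 * g"
proof -
  obtain ps where "optimal ps n" using ex_optimal by blast
  note ps = optimalD(1-3)[OF this] and t = optimalD(4)[OF this]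
  have "p ^ Suc (Suc r) \<le> p ^ s" using g(1,2) p20 by (intro power_increasing) auto
  moreover have "2 * p ^ Suc r \<le> p ^ Suc (Suc r)" using p20 by simp
  ultimately have "2 * p ^ Suc r \<le> p ^ s" by linarith
  then have "2 * m \<le> p ^ s" using m by linarith
  then have "2 * real m \<le> real p ^ s" by (metis of_nat_le_iff of_nat_mult of_nat_numeral of_nat_power)
  moreover have n: "psum ps = real p ^ s - real m" using ps(1) by (simp add: n_def)
  moreover have "real p ^ s < real p ^ Suc s" using p20 by simp
  ultimately have "real p ^ s / 2 \<le> \<bar>psum ps\<bar>" "\<bar>psum ps\<bar> < real p ^ Suc s" by linarith+
  moreover have "2 * length ps \<le> p ^ g" using ps(3) g(3) by simp
  ultimately obtain e where e: "e \<in> levels ps" "\<bar>e - int s\<bar> \<le> int g"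
    using level_near[OF ps(2) g(1)] by blast
  \<comment> \<open>Cancelling \<open>p^s\<close> exposes the order \<open>p^r\<close> of
    \<open>m\<close>. The added level \<open>s\<close> is farther than \<open>g\<close> from
    \<open>r\<close>, so the level found belongs to \<open>ps\<close>.\<close>
  have "psum ((-1, int s) # ps) = - real m" using n by simp
  moreover have "real p ^ r \<le> real m" using m(1) by (metis of_nat_le_iff of_nat_power)
  moreover have "real m < real p ^ Suc r" using m(2) by (metis of_nat_less_iff of_nat_power)
  moreover have "0 \<le> real p ^ r" by simp
  ultimately have "real p ^ r / 2 \<le> \<bar>psum ((-1, int s) # ps)\<bar>" "\<bar>psum ((-1, int s) # ps)\<bar> < real p ^ Suc r"
    by linarith+
  moreover have "2 * length ((-1 :: real, int s) # ps) \<le> p ^ g" using ps(3) g(3) by simp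
  moreover have "units ((-1, int s) # ps)" using ps(2) by simp
  ultimately obtain e' where e': "e' \<in> levels ((-1, int s) # ps)" "\<bar>e' - int r\<bar> \<le> int g"
    using level_near[OF _ g(1)] by blast
  then have e'l: "e' \<in> levels ps" using g(2) by auto
  have "alen e + alen (e' - e) + alen e' \<le> alen n"
    using t[OF e(1) e'l] alen_le_shift_cost[of e] alen_le_shift_cost[of e'] alen_le_shift_cost[of "e' - e"]
    by linarith
  moreover have "alen (int s) \<le> alen e + g" using alen_lipschitz[of "int s" e] e(2) by linarith
  moreover have "alen (int r) \<le> alen e' + g" using alen_lipschitz[of "int r" e'] e'(2) by linarith
  moreover have "alen (int r - int s) \<le> alen (e' - e) + 2 * g"
    using alen_lipschitz[of "int r - int s" "e' - e"] e(2) e'(2) by linarith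
  moreover have "alen (int s - int r) = alen (int r - int s)" using alen_minus[of "int r - int s"] by simp
  ultimately show ?thesis by linarith
qed

text \<open>Supplies the room \<open>r + g < s\<close> that \<open>alen_complement_step\<close>
  requires.\<close>

lemma tower_gap: "tower 1 k + 4 * k + 1 \<le> tower 2 k"
proof (induction k)
  case (Suc k)
  define d where "d = 4 * k + 1"
  have "d + 5 \<le> p ^ d"
  proof -
    have "1 \<le> d" by (simp add: d_def)
    then show ?thesis
    proof (induction d rule: dec_induct)
      case (step d)
      have "Suc d + 5 \<le> 2 * p ^ d" using step by simp
      also have "\<dots> \<le> p ^ Suc d" using p20 by simp
      finally show ?case .
    qed (use p20 in simp)
  qed
  moreover have "1 * (d + 4) \<le> p ^ tower 1 k * (d + 4)" using p20 by (intro mult_le_mono1) simp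
  ultimately have "p ^ tower 1 k + (d + 4) \<le> p ^ tower 1 k * p ^ d"
    using mult_le_mono2[of "d + 5" "p ^ d" "p ^ tower 1 k"] by (simp add: algebra_simps)
  also have "\<dots> = p ^ (tower 1 k + d)" by (simp add: power_add)
  also have "\<dots> \<le> p ^ tower 2 k" using Suc p20 d_def by (intro power_increasing) auto
  finally show ?case by (simp add: d_def)
qed simp

lemma tower_ge: "k < tower 1 k"
proof (induction k)
  case (Suc k)
  have "tower 1 k < p ^ tower 1 k" using p20 by (intro power_gt_expt) simp
  then show ?case using Suc by simp
qed simp

text \<open>The constant 10240 covers the levels \<open>k \<le> 9\<close>; beyond them the factor 17/12 reproduces
  itself with room for the error \<open>4 g\<close>, which is only linear in \<open>k\<close>.\<close>

lemma alen_complement: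
  "tower 1 k \<le> m \<Longrightarrow> m \<le> tower 1 (Suc k) \<Longrightarrow>
    238 * 2 ^ k \<le> 12 * (alen (int (tower 2 (Suc k)) - int m) + 10240)"
proof (induction k arbitrary: m)
  case 0
  show ?case by simp
next
  case (Suc k)
  define s where "s = tower 2 (Suc k)"
  define n where "n = int (p ^ s) - int m"
  have n: "int (tower 2 (Suc (Suc k))) - int m = n" by (simp add: n_def s_def)
  show ?case
  proof (cases "k < 9")
    case True
    then have "(2::nat) ^ Suc k \<le> 2 ^ 9" by (intro power_increasing) auto
    then show ?thesis by simp
  next
    case False
    \<comment> \<open>The final estimates combine to
      \<open>478 * 2^k - 123000 < 476 * 2^k - 122880 + 48 * k + 96\<close>, that is
      \<open>2^k < 108 + 24 * k\<close>.\<close>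
    have k: "108 + 24 * k \<le> 2 ^ k"
    proof -
      have "9 \<le> k" using False by simp
      then show ?thesis by (induction k rule: dec_induct) simp_all
    qed
    show ?thesis
    proof (rule ccontr)
      assume "\<not> ?thesis"
      \<comment> \<open>The negated claim bounds \<open>alen n\<close> from above, which makes
        \<open>g = k + 2\<close> large enough.\<close>
      then have short: "12 * (alen n + 10240) < 476 * 2 ^ k" unfolding n by simp
      then have short': "12 * alen n + 122880 < 476 * 2 ^ k" by simp
      have "1 \<le> m" using Suc.prems(1) p20 by (metis One_nat_def Suc_leI le_trans tower_ge zero_less_Suc less_le_trans)
      \<comment> \<open>The exponent \<open>r\<close> lies between the towers one level down, so the
        induction hypothesis applies to it, with \<open>s\<close> as the larger tower.\<close>
      then obtain r where r: "p ^ r \<le> m" "m < p ^ Suc r"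
        using ex_power_ivl1[of p m] p20 by auto
      have "p ^ tower 1 k < p ^ Suc r" using Suc.prems(1) r(2) by simp
      then have r1: "tower 1 k \<le> r" using p20 by (simp add: power_strict_increasing_iff del: power_Suc)
      have "p ^ r \<le> p ^ tower 1 (Suc k)" using Suc.prems(2) r(1) by simp
      then have r2: "r \<le> tower 1 (Suc k)" using p20 by (simp add: power_increasing_iff del: tower.simps)
      have "2 * (alen n + 1) \<le> 400 * 2 ^ k" using short by simp
      also have "(400 :: nat) * 2 ^ k \<le> p ^ 2 * p ^ k"
        using p20 power_mono[of 20 p 2] by (intro mult_le_mono power_mono) auto
      also have "\<dots> = p ^ (k + 2)" by (simp add: power_add power2_eq_square)
      finally have g: "2 * (alen n + 1) \<le> p ^ (k + 2)" .
      have "r + (k + 2) < s" using r2 tower_gap[of "Suc k"] unfolding s_def by (simp del: tower.simps)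
      from alen_complement_step[OF r _ this, folded n_def, OF _ g]
      have "alen (int s) + alen (int s - int r) + alen (int r) \<le> alen n + 4 * k + 8" by simp
      moreover have "238 * 2 ^ k \<le> 12 * alen (int s - int r) + 122880"
        using Suc.IH[OF r1 r2] by (simp add: s_def del: tower.simps)
      moreover have "14 * 2 ^ k \<le> alen (int s) + 5"
        using alen_ge_tower[of 2 "Suc k" "int s"] by (simp add: s_def)
      moreover have "6 * 2 ^ k \<le> alen (int r) + 5"
        using alen_ge_tower[of 1 k "int r"] r1 by simp
      ultimately show False using short' k by linarith
    qed
  qed
qed

section \<open>Short words for towers\<close>

lemma eqv_append:
  assumes "eqv p u u'" "eqv p v v'" shows "eqv p (u @ v) (u' @ v')"
proof -
  have ctx: "eqv p (x @ u @ y) (x @ u' @ y)" if "eqv p u u'" for x y u u'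
    using that
  proof (induction rule: eqv.induct)
    case (eqv_cancel u z v)
    show ?case using eqv.eqv_cancel[of p "x @ u" z "v @ y"] by simp
  next
    case (eqv_rel u v)
    show ?case using eqv.eqv_rel[of p "x @ u" "v @ y"] by simp
  qed (blast intro: eqv.intros)+
  show ?thesis using ctx[OF assms(1), of "[]" v] ctx[OF assms(2), of u' "[]"]
    by (simp add: eqv_trans)
qed

lemma eqv_inv_right: "eqv p (w @ inv_word w) []"
proof (induction w rule: rev_induct)
  case (snoc x w)
  have "eqv p (w @ [x, inv_letter x] @ inv_word w) (w @ inv_word w)" by (rule eqv_cancel)
  with snoc show ?case by (auto simp: inv_word_def intro: eqv_trans)
qed (simp add: inv_word_def eqv_refl)

lemma inv_word_inv: "inv_word (inv_word w) = w"
proof -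
  have "inv_letter (inv_letter x) = x" for x by (cases x) simp
  then show ?thesis by (simp add: inv_word_def rev_map o_def)
qed

lemma eqv_inv_left: "eqv p (inv_word w @ w) []"
  using eqv_inv_right[of "inv_word w"] by (simp add: inv_word_inv)

lemma eqv_inv:
  assumes "eqv p u v" shows "eqv p (inv_word u) (inv_word v)"
proof -
  have "eqv p (inv_word u @ (v @ inv_word v)) (inv_word u @ [])"
    by (intro eqv_append eqv_refl eqv_inv_right)
  moreover have "eqv p (inv_word u @ (v @ inv_word v)) (inv_word u @ (u @ inv_word v))"
    by (intro eqv_append eqv_refl eqv_sym[OF assms])
  moreover have "eqv p ((inv_word u @ u) @ inv_word v) ([] @ inv_word v)"
    by (intro eqv_append eqv_refl eqv_inv_left)
  ultimately show ?thesis by (simp, meson eqv_sym eqv_trans)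
qed

lemma inv_word_power: "inv_word (replicate n (A, b)) = replicate n (A, \<not> b)"
  by (simp add: inv_word_def)

definition b_word :: "bool \<Rightarrow> word" where
  "b_word c = [(T, True), (A, c), (T, False)]"

lemma inv_b_word: "inv_word (b_word c) = b_word (\<not> c)"
  by (simp add: inv_word_def b_word_def)

lemma eqv_b_cancel: "eqv p (b_word c @ b_word (\<not> c)) []"
  using eqv_inv_right[of "b_word c"] by (simp add: inv_b_word)

lemma b_conj_a: "eqv p (b_word True @ [(A, c)] @ b_word False) (replicate p (A, c))"
proof -
  let ?w = "b_word True @ [(A, False)] @ b_word False"
  have "eqv p ([] @ relator p @ replicate p (A, False)) ([] @ replicate p (A, False))"
    by (rule eqv_rel)
  then have 1: "eqv p (?w @ replicate p (A, True) @ replicate p (A, False)) (replicate p (A, False))"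
    by (simp add: relator_def b_word_def)
  have "eqv p (?w @ replicate p (A, True) @ replicate p (A, False)) (?w @ [])"
    using eqv_inv_left[of "replicate p (A, False)"]
    by (intro eqv_append eqv_refl) (simp add: inv_word_power)
  with 1 have w: "eqv p ?w (replicate p (A, False))"
    by (simp, meson eqv_sym eqv_trans)
  show ?thesis
  proof (cases c)
    case True
    have "inv_word ?w = b_word True @ [(A, True)] @ b_word False"
      by (simp add: inv_word_def b_word_def)
    then show ?thesis using eqv_inv[OF w] True by (simp add: inv_word_power)
  qed (use w in simp)
qed

lemma b_conj_a_power:
  "eqv p (b_word True @ replicate n (A, c) @ b_word False) (replicate (p * n) (A, c))"
proof (induction n)
  case 0
  show ?case using eqv_b_cancel[of True] by simp
next
  case (Suc n)
  have "eqv p ((b_word True @ [(A, c)]) @ (b_word False @ b_word True) @ (replicate n (A, c) @ b_word False))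
      ((b_word True @ [(A, c)]) @ [] @ (replicate n (A, c) @ b_word False))"
    using eqv_b_cancel[of False] by (intro eqv_append eqv_refl) simp
  moreover have "eqv p ((b_word True @ [(A, c)] @ b_word False) @ (b_word True @ replicate n (A, c) @ b_word False))
      (replicate p (A, c) @ replicate (p * n) (A, c))"
    by (intro eqv_append b_conj_a Suc)
  ultimately show ?case
    by (simp add: replicate_add) (meson eqv_sym eqv_trans)
qed

text \<open>Spells \<open>b^s\<close> or \<open>b^-s\<close> with only two stable letters, so that a
  short word for the inner power can be substituted.\<close>

definition wrap :: "nat \<Rightarrow> bool \<Rightarrow> word" where
  "wrap s c = [(T, True)] @ replicate s (A, c) @ [(T, False)]"

lemma wrap_Suc: "eqv p (wrap (Suc s) c) (b_word c @ wrap s c)" "eqv p (wrap (Suc s) c) (wrap s c @ b_word c)"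
proof -
  have "eqv p (([(T, True), (A, c)]) @ [(T, False), inv_letter (T, False)] @ (replicate s (A, c) @ [(T, False)]))
     (([(T, True), (A, c)]) @ (replicate s (A, c) @ [(T, False)]))" by (rule eqv_cancel)
  then show "eqv p (wrap (Suc s) c) (b_word c @ wrap s c)"
    by (simp add: wrap_def b_word_def eqv_sym)
  have "eqv p (((T, True) # replicate s (A, c)) @ [(T, False), inv_letter (T, False)] @ [(A, c), (T, False)])
     (((T, True) # replicate s (A, c)) @ [(A, c), (T, False)])" by (rule eqv_cancel)
  then show "eqv p (wrap (Suc s) c) (wrap s c @ b_word c)"
    by (simp add: wrap_def b_word_def eqv_sym replicate_append_same[symmetric])
qed

lemma wrap_conj_a: "eqv p (wrap s True @ [(A, c)] @ wrap s False) (replicate (p ^ s) (A, c))"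
proof (induction s)
  case 0
  have 0: "eqv p (wrap 0 d) []" for d
    using eqv_inv_right[of "[(T, True)]"] by (simp add: wrap_def inv_word_def)
  have "eqv p (wrap 0 True @ [(A, c)] @ wrap 0 False) ([] @ [(A, c)] @ [])"
    by (intro eqv_append eqv_refl 0)
  then show ?case by simp
next
  case (Suc s)
  have "eqv p (wrap (Suc s) True @ [(A, c)] @ wrap (Suc s) False)
      ((b_word True @ wrap s True) @ [(A, c)] @ (wrap s False @ b_word False))"
    by (intro eqv_append eqv_refl wrap_Suc)
  moreover have "eqv p (b_word True @ (wrap s True @ [(A, c)] @ wrap s False) @ b_word False)
      (b_word True @ replicate (p ^ s) (A, c) @ b_word False)"
    by (intro eqv_append eqv_refl Suc)
  moreover note b_conj_a_power[of "p ^ s" c]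
  ultimately show ?case by simp (meson eqv_trans)
qed

text \<open>By \<open>b^-s a b^s = a^(p^s)\<close>, words for \<open>a^-s\<close> and
  \<open>a^s\<close> of length \<open>L\<close> give one of length \<open>2 * (L + 2) + 1\<close>.
  This is the recursion of the thresholds in \<open>short_imp_small\<close>.\<close>

lemma short_word_tower:
  "\<exists>u. \<forall>c. eqv p (u c) (replicate (tower v k) (A, c)) \<and> length (u c) + 5 = (v + 5) * 2 ^ k"
proof (induction k)
  case 0
  show ?case by (rule exI[of _ "\<lambda>c. replicate v (A, c)"]) (simp add: eqv_refl)
next
  case (Suc k)
  then obtain u where u: "\<And>c. eqv p (u c) (replicate (tower v k) (A, c))"
    and l: "\<And>c. length (u c) + 5 = (v + 5) * 2 ^ k" by blast
  define w where "w c = [(T, True)] @ u c @ [(T, False)]" for c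
  have w: "eqv p (w c) (wrap (tower v k) c)" for c
    unfolding w_def wrap_def by (intro eqv_append eqv_refl u)
  have "eqv p (w True @ [(A, c)] @ w False) (replicate (tower v (Suc k)) (A, c))" for c
    using eqv_trans[OF eqv_append[OF w eqv_append[OF eqv_refl w]] wrap_conj_a] by simp
  moreover have "length (w True @ [(A, c)] @ w False) + 5 = (v + 5) * 2 ^ Suc k" for c
    using l[of True] l[of False] by (simp add: w_def)
  ultimately show ?case by (intro exI[of _ "\<lambda>c. w True @ [(A, c)] @ w False"]) blast
qed

section \<open>Word lengths and cones\<close>

lemma wlen_le: "eqv p v w \<Longrightarrow> wlen p w \<le> length v"
  unfolding wlen_def by (rule Least_le) blast

lemma alen_le_wlen: "alen (int n) \<le> wlen p (replicate n (A, c))"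
proof -
  have "\<exists>v. length v = wlen p (replicate n (A, c)) \<and> eqv p v (replicate n (A, c))"
    unfolding wlen_def by (rule LeastI[of _ n]) (use eqv_refl in force)
  then obtain v where v: "length v = wlen p (replicate n (A, c))" "eqv p v (replicate n (A, c))" by blast
  from alen_le[OF eqv_power_reach[OF v(2)]] v(1) show ?thesis by (cases c) auto
qed

lemma wlen_complement:
  "\<exists>n. wlen p (replicate (m + n) (A, c)) \<le> 12 / 17 * wlen p (replicate n (A, c)) + real 10240"
proof (cases "m = 0")
  case True
  have "wlen p (replicate 0 (A, c)) \<le> 0" using wlen_le[OF eqv_refl, of "[]"] by simp
  with True show ?thesis by (intro exI[of _ 0]) simp
next
  case False
  define k where "k = (LEAST k. m \<le> tower 1 (Suc k))"
  have "m \<le> tower 1 (Suc m)" using tower_ge[of "Suc m"] by linarith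
  then have k: "m \<le> tower 1 (Suc k)" unfolding k_def by (rule LeastI)
  have k': "tower 1 k \<le> m"
  proof (cases k)
    case 0
    with False show ?thesis by simp
  next
    case (Suc j)
    then show ?thesis using not_less_Least[of j "\<lambda>k. m \<le> tower 1 (Suc k)"] k_def by simp
  qed
  define N where "N = tower 2 (Suc k)"
  have mN: "m \<le> N" using k tower_gap[of "Suc k"] N_def by linarith
  obtain u where "eqv p u (replicate N (A, c))" "length u + 5 = 7 * 2 ^ Suc k"
    using short_word_tower[of 2 "Suc k"] N_def by auto
  \<comment> \<open>Here \<open>7 * 2^(k+1) = 14 * 2^k\<close>, and \<open>17 * 14 = 238\<close>
    links this to \<open>alen_complement\<close>.\<close>
  then have "wlen p (replicate N (A, c)) \<le> 14 * 2 ^ k" using wlen_le by fastforce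
  moreover have "238 * 2 ^ k \<le> 12 * (alen (int N - int m) + 10240)"
    using alen_complement[OF k' k] N_def by simp
  moreover have "alen (int N - int m) \<le> wlen p (replicate (N - m) (A, c))"
    using alen_le_wlen[of "N - m" c] mN by (simp add: of_nat_diff)
  ultimately have "17 * wlen p (replicate N (A, c)) \<le> 12 * wlen p (replicate (N - m) (A, c)) + 12 * 10240"
    by simp
  then have "wlen p (replicate N (A, c)) \<le> 12 / 17 * wlen p (replicate (N - m) (A, c)) + real 10240"
    by linarith
  then show ?thesis using mN by (intro exI[of _ "N - m"]) simp
qed

text \<open>The two values of \<open>c\<close> give the two inclusions in the definition of
  \<open>s_set\<close>.\<close>

lemma orbit_in_cone_inverse: "orbit_in_cone p (12 / 17) 10240 [(A, \<not> c)] [(A, c)]"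
proof -
  have "inv_word (replicate m (A, \<not> c)) @ replicate n (A, c) = replicate (m + n) (A, c)" for m n
    by (simp add: inv_word_power replicate_add)
  moreover have "inv_word [] @ w = w" for w by (simp add: inv_word_def)
  ultimately show ?thesis using wlen_complement
    by (simp add: orbit_in_cone_def in_cone_def wdist_def wpow_singleton)
qed

end

theorem theorem4p3:
  fixes p :: nat
  assumes "p \<ge> 20"
  shows "infinite_order p [(A,False)] \<and> s_set p [(A,False)] [(A,True)] \<noteq> {}
         \<and> t_orb p [(A,False)] [(A,True)] \<le> sqrt (12/17)"
proof (intro conjI)
  show "infinite_order p [(A,False)]"
    using power_a_nontrivial[OF assms] by (auto simp: infinite_order_def wpow_singleton)
  have mem: "12 / 17 \<in> s_set p [(A,False)] [(A,True)]"
    using orbit_in_cone_inverse[OF assms, of True] orbit_in_cone_inverse[OF assms, of False]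
    by (auto simp: s_set_def)
  then show "s_set p [(A,False)] [(A,True)] \<noteq> {}" by blast
  have "bdd_below (s_set p [(A,False)] [(A,True)])"
    by (rule bdd_belowI[of _ 0]) (simp add: s_set_def)
  with mem show "t_orb p [(A,False)] [(A,True)] \<le> sqrt (12/17)"
    unfolding t_orb_def s_orb_def by (intro real_sqrt_le_mono cInf_lower)
qed

end
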